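(* Let $n>1$ be an integer. A set of cells $S$ with an $n$-coloring is a $(p,n)$-prismatic polyomino, where $p$ is the square tetromino, if and only if $f(S)$ with the induced coloring is a $(q,n)$-prismatic polyomino, where $q$ is the Z tetromino. In particular, the row shift restricts to a bijection from $(p,n)$-prismatic polyominoes to $(q,n)$-prismatic polyominoes.
   Context: Cells are the unit squares of the square lattice, indexed by integer coordinates $(x,y)$. A polyomino is a finite nonempty edge-connected set of cells; its size is its number of cells; polyominoes are considered up to translation. The row shift is $f(x,y)=(x-y,y)$, applied to sets of cells elementwise, and a coloring $\chi$ of $S$ induces the coloring $\chi'(f(c))=\chi(c)$ of $f(S)$. The square tetromino is $\{(0,0),(1,0),(0,1),(1,1)\}$; the Z tetromino is $\{(0,0),(1,0),(1,-1),(2,-1)\}$. An $n$-coloring assigns each cell a color in $\{1,\dots,n\}$. An instance of a shape is a translate of it; an instance contained in a colored set is colored by restriction, and two instances have the same coloring if the colorings agree under the translation. A de Bruijn polyomino for $(p,n)$ is an $n$-colored polyomino containing exactly one instance of each of the $n^{|p|}$ distinct $n$-colorings of $p$; a $(p,n)$-prismatic polyomino is a de Bruijn polyomino for $(p,n)$ of minimum size. *)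

theory Defs
  imports Main "HOL-Library.Product_Plus"
begin

type_synonym cell = "int \<times> int"

text \<open>A colored set of cells is a partial function; its underlying set of cells is its domain.\<close>

type_synonym colored_set = "cell \<rightharpoonup> nat"

definition adjacent :: "cell \<Rightarrow> cell \<Rightarrow> bool" where
  "adjacent c d \<longleftrightarrow> \<bar>fst c - fst d\<bar> + \<bar>snd c - snd d\<bar> = 1"

definition edge_connected :: "cell set \<Rightarrow> bool" where
  "edge_connected S \<longleftrightarrow>
     (\<forall>c\<in>S. \<forall>d\<in>S. (c, d) \<in> {(a, b). a \<in> S \<and> b \<in> S \<and> adjacent a b}\<^sup>*)"

definition polyomino :: "cell set \<Rightarrow> bool" where
  "polyomino S \<longleftrightarrow> finite S \<and> S \<noteq> {} \<and> edge_connected S"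

definition n_coloring :: "nat \<Rightarrow> cell set \<Rightarrow> colored_set \<Rightarrow> bool" where
  "n_coloring n S \<chi> \<longleftrightarrow> dom \<chi> = S \<and> ran \<chi> \<subseteq> {1..n}"

definition translate :: "cell \<Rightarrow> cell set \<Rightarrow> cell set" where
  "translate v S = (\<lambda>c. c + v) ` S"

definition translate_colored :: "cell \<Rightarrow> colored_set \<Rightarrow> colored_set" where
  "translate_colored v \<chi> = (\<lambda>c. \<chi> (c - v))"

lemma dom_translate_colored: "dom (translate_colored v \<chi>) = translate v (dom \<chi>)"
proof
  show "dom (translate_colored v \<chi>) \<subseteq> translate v (dom \<chi>)"
  proof
    fix c assume "c \<in> dom (translate_colored v \<chi>)"
    then have "c - v \<in> dom \<chi>" by (auto simp: translate_colored_def)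
    moreover have "c = (c - v) + v" by simp
    ultimately show "c \<in> translate v (dom \<chi>)" unfolding translate_def by blast
  qed
qed (auto simp: translate_def translate_colored_def)

text \<open>Equality of colored sets up to translation; on instances of a common shape this says that
  their colorings agree under the translation.\<close>

definition translation_rel :: "colored_set rel" where
  "translation_rel = {(\<chi>, \<chi>'). \<exists>v. \<chi>' = translate_colored v \<chi>}"

definition instances :: "cell set \<Rightarrow> cell set \<Rightarrow> cell set set" where
  "instances p S = {T. (\<exists>v. T = translate v p) \<and> T \<subseteq> S}"

definition de_bruijn_polyomino :: "cell set \<Rightarrow> nat \<Rightarrow> colored_set \<Rightarrow> bool" where
  "de_bruijn_polyomino p n \<chi> \<longleftrightarrow>
     polyomino (dom \<chi>) \<and> n_coloring n (dom \<chi>) \<chi> \<and>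
     (\<forall>\<kappa>. n_coloring n p \<kappa> \<longrightarrow>
        (\<exists>!T. T \<in> instances p (dom \<chi>) \<and> (\<kappa>, \<chi> |` T) \<in> translation_rel))"

definition prismatic_polyomino :: "cell set \<Rightarrow> nat \<Rightarrow> colored_set \<Rightarrow> bool" where
  "prismatic_polyomino p n \<chi> \<longleftrightarrow>
     de_bruijn_polyomino p n \<chi> \<and>
     (\<forall>\<psi>. de_bruijn_polyomino p n \<psi> \<longrightarrow> card (dom \<chi>) \<le> card (dom \<psi>))"

definition row_shift :: "cell \<Rightarrow> cell" where
  "row_shift = (\<lambda>(x, y). (x - y, y))"

definition row_shift_colored :: "colored_set \<Rightarrow> colored_set" where
  "row_shift_colored \<chi> = \<chi> \<circ> inv row_shift"

lemma bij_row_shift: "bij row_shift"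
  by (rule o_bij[where g = "\<lambda>(x, y). (x + y, y)"]) (auto simp: row_shift_def)

lemma row_shift_colored_apply: "row_shift_colored \<chi> (row_shift c) = \<chi> c"
  by (simp add: row_shift_colored_def bij_is_inj[OF bij_row_shift])

lemma dom_row_shift_colored: "dom (row_shift_colored \<chi>) = row_shift ` dom \<chi>"
proof
  show "dom (row_shift_colored \<chi>) \<subseteq> row_shift ` dom \<chi>"
  proof
    fix d assume d: "d \<in> dom (row_shift_colored \<chi>)"
    obtain c where "d = row_shift c" using bij_is_surj[OF bij_row_shift] by (metis surjD)
    then show "d \<in> row_shift ` dom \<chi>" using d by (auto simp: row_shift_colored_apply)
  qed
qed (auto simp: row_shift_colored_apply)

definition square_tetromino :: "cell set" where
  "square_tetromino = {(0, 0), (1, 0), (0, 1), (1, 1)}"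

definition Z_tetromino :: "cell set" where
  "Z_tetromino = {(0, 0), (1, 0), (1, -1), (2, -1)}"

end

theory Submission
  imports Defs "HOL-Library.Discrete_Functions" "HOL-Number_Theory.Cong"
begin

text \<open>The row shift maps the square tetromino to a translate of the Z tetromino, so it transports
  every condition except edge-connectedness. It therefore suffices to show that the minimum size is
  attained only by sets whose connectedness survives the shift. Let \<open>T\<close> be the set of positions of
  the \<open>n\<^sup>4\<close> square windows, occupying \<open>R\<close> rows and \<open>C\<close> columns. Adding the right neighbours of \<open>T\<close>
  costs at least \<open>R\<close> cells, and then adding the upper neighbours at least \<open>C + 1\<close> more; since
  \<open>R * C \<ge> n\<^sup>4\<close>, at least \<open>(n\<^sup>2 + 1)\<^sup>2\<close> cells are needed, with equality only for a filled square. The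
  bound is attained: use as columns cyclic shifts of a de Bruijn sequence of order 2, with pairwise
  distinct differences between consecutive shifts.\<close>

section \<open>The window condition\<close>

text \<open>Counts positions \<open>v\<close> instead of instances. Since \<open>\<kappa>\<close> is
  defined on all of \<open>p\<close>, the equation also forces the translate of \<open>p\<close>
  into \<open>dom \<chi>\<close>.\<close>

definition unique_windows :: "cell set \<Rightarrow> nat \<Rightarrow> colored_set \<Rightarrow> bool" where
  "unique_windows p n \<chi> \<longleftrightarrow>
     (\<forall>\<kappa>. n_coloring n p \<kappa> \<longrightarrow> (\<exists>!v. \<forall>c\<in>p. \<chi> (c + v) = \<kappa> c))"

text \<open>Translating by \<open>v\<close> adds \<open>card p\<close> times \<open>v\<close> to the
  sum of all cells, so the translate determines \<open>v\<close>.\<close>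

lemma translate_inj:
  assumes "finite p" "p \<noteq> {}" "translate v p = translate w p"
  shows "v = w"
proof -
  have "(\<Sum>c\<in>translate u p. c) = (\<Sum>c\<in>p. c + u)" for u
    unfolding translate_def by (subst sum.reindex) (auto simp: inj_on_def)
  then have "(\<Sum>c\<in>p. c + v) = (\<Sum>c\<in>p. c + w)"
    using assms(3) by metis
  then have "(\<Sum>c\<in>p. v) = (\<Sum>c\<in>p. w)"
    by (simp add: sum.distrib)
  then have "fst (\<Sum>c\<in>p. v) = fst (\<Sum>c\<in>p. w)" "snd (\<Sum>c\<in>p. v) = snd (\<Sum>c\<in>p. w)"
    by simp_all
  moreover have "fst (\<Sum>c\<in>p. u) = of_nat (card p) * fst u" 
    "snd (\<Sum>c\<in>p. u) = of_nat (card p) * snd u" for u :: cell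
    using assms(1) by (induction p) (auto simp: algebra_simps)
  ultimately show ?thesis
    using assms(1,2) by (simp add: prod_eq_iff)
qed

lemma restrict_eq_translate_iff:
  assumes "dom \<kappa> = p"
  shows "T \<in> instances p (dom \<chi>) \<and> (\<kappa>, \<chi> |` T) \<in> translation_rel \<longleftrightarrow>
    (\<exists>v. T = translate v p \<and> (\<forall>c\<in>p. \<chi> (c + v) = \<kappa> c))" (is "?L \<longleftrightarrow> ?R")
proof
  assume ?L
  then obtain v where v: "\<chi> |` T = translate_colored v \<kappa>" and T: "T \<subseteq> dom \<chi>"
    by (auto simp: translation_rel_def instances_def)
  \<comment> \<open>The vector of the colored translation need not be the one that makes
    \<open>T\<close> an instance; comparing domains shows that it also carries \<open>p\<close> to
    \<open>T\<close>.\<close>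
  have "T = translate v p"
    using arg_cong[OF v, of dom] T assms by (simp add: dom_translate_colored Int_absorb1)
  moreover have "\<chi> (c + v) = \<kappa> c" if "c \<in> p" for c
    using fun_cong[OF v, of "c + v"] that calculation
    by (auto simp: translate_colored_def translate_def restrict_map_def)
  ultimately show ?R by blast
next
  assume ?R
  then obtain v where T: "T = translate v p" and v: "\<forall>c\<in>p. \<chi> (c + v) = \<kappa> c" by blast
  have "\<chi> |` T = translate_colored v \<kappa>"
  proof
    fix d
    have "d \<in> T \<longleftrightarrow> d - v \<in> p"
      unfolding T translate_def by (force simp: image_iff)
    moreover have "\<kappa> (d - v) = None" if "d - v \<notin> p"
      using that assms by (auto simp: dom_def)
    ultimately show "(\<chi> |` T) d = translate_colored v \<kappa> d"
      using v by (auto simp: restrict_map_def translate_colored_def dest: bspec[of _ _ "d - v"])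
  qed
  moreover have "T \<subseteq> dom \<chi>"
    using v assms unfolding T translate_def by (auto simp: dom_def)
  ultimately show ?L
    using T unfolding translation_rel_def instances_def by blast
qed

text \<open>Moves unique existence along an injection: from positions to instances, and later along
  the row shift.\<close>

lemma ex1_image_iff:
  assumes "inj f"
  shows "(\<exists>!y. \<exists>x. y = f x \<and> P x) \<longleftrightarrow> (\<exists>!x. P x)"
proof
  assume "\<exists>!y. \<exists>x. y = f x \<and> P x"
  then obtain x where "P x" "\<And>x'. P x' \<Longrightarrow> f x' = f x" by blast
  then show "\<exists>!x. P x" by (intro ex1I[of _ x] injD[OF assms])
next
  assume "\<exists>!x. P x"
  then obtain x where "P x" "\<And>x'. P x' \<Longrightarrow> x' = x" by blast
  then show "\<exists>!y. \<exists>x. y = f x \<and> P x" by blast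
qed

lemma de_bruijn_polyomino_iff:
  assumes "finite p" "p \<noteq> {}"
  shows "de_bruijn_polyomino p n \<chi> \<longleftrightarrow>
    polyomino (dom \<chi>) \<and> n_coloring n (dom \<chi>) \<chi> \<and> unique_windows p n \<chi>"
proof -
  have "(\<exists>!T. T \<in> instances p (dom \<chi>) \<and> (\<kappa>, \<chi> |` T) \<in> translation_rel) \<longleftrightarrow>
      (\<exists>!v. \<forall>c\<in>p. \<chi> (c + v) = \<kappa> c)" if "n_coloring n p \<kappa>" for \<kappa>
  proof -
    have "dom \<kappa> = p" using that by (simp add: n_coloring_def)
    then show ?thesis
      unfolding restrict_eq_translate_iff[OF \<open>dom \<kappa> = p\<close>]
      by (intro ex1_image_iff injI translate_inj[OF assms])
  qed
  then show ?thesis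
    unfolding de_bruijn_polyomino_def unique_windows_def by auto
qed

text \<open>If a lower bound \<open>K\<close> holds even for disconnected sets, is attained, and
  forces connectedness when met, then connectedness disappears from the description. The three
  remaining conditions all survive the row shift.\<close>

lemma prismatic_polyomino_iff:
  assumes p: "finite p" "p \<noteq> {}" and "K > 0"
    and attained: "\<exists>\<psi>. n_coloring n (dom \<psi>) \<psi> \<and> unique_windows p n \<psi> \<and> card (dom \<psi>) = K"
    and bound: "\<And>\<psi>. unique_windows p n \<psi> \<Longrightarrow> finite (dom \<psi>) \<Longrightarrow> K \<le> card (dom \<psi>)"
    and extremal: "\<And>\<psi>. unique_windows p n \<psi> \<Longrightarrow> card (dom \<psi>) = K \<Longrightarrow> edge_connected (dom \<psi>)"
  shows "prismatic_polyomino p n \<chi> \<longleftrightarrow>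
    n_coloring n (dom \<chi>) \<chi> \<and> unique_windows p n \<chi> \<and> card (dom \<chi>) = K"
proof -
  \<comment> \<open>Infinite sets have \<open>card\<close> 0, so \<open>K > 0\<close> gives
    finiteness as well as nonemptiness.\<close>
  have poly: "polyomino (dom \<psi>)" if "unique_windows p n \<psi>" "card (dom \<psi>) = K" for \<psi>
    using extremal[OF that] that(2) \<open>K > 0\<close> unfolding polyomino_def
    by (metis card.empty card.infinite less_irrefl)
  obtain \<psi>\<^sub>0 where \<psi>\<^sub>0: "de_bruijn_polyomino p n \<psi>\<^sub>0" "card (dom \<psi>\<^sub>0) = K"
    using attained poly unfolding de_bruijn_polyomino_iff[OF p] by blast
  have "K \<le> card (dom \<psi>)" if "de_bruijn_polyomino p n \<psi>" for \<psi>
    using that bound unfolding de_bruijn_polyomino_iff[OF p] polyomino_def by blast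
  then have "prismatic_polyomino p n \<chi> \<longleftrightarrow> de_bruijn_polyomino p n \<chi> \<and> card (dom \<chi>) = K"
    unfolding prismatic_polyomino_def using \<psi>\<^sub>0 by (metis le_antisym)
  then show ?thesis
    using poly unfolding de_bruijn_polyomino_iff[OF p] by blast
qed

section \<open>The row shift\<close>

lemma row_shift_add: "row_shift (c + d) = row_shift c + row_shift d"
  by (auto simp: row_shift_def split_beta)

lemma bij_row_shift_colored: "bij row_shift_colored"
proof (rule o_bij)
  show "(\<lambda>\<chi>. \<chi> \<circ> row_shift) \<circ> row_shift_colored = id"
    by (auto simp: fun_eq_iff row_shift_colored_apply)
  show "row_shift_colored \<circ> (\<lambda>\<chi>. \<chi> \<circ> row_shift) = id"
    using bij_is_surj[OF bij_row_shift] by (auto simp: fun_eq_iff row_shift_colored_def surj_f_inv_f)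
qed

lemma card_dom_row_shift_colored: "card (dom (row_shift_colored \<chi>)) = card (dom \<chi>)"
  unfolding dom_row_shift_colored
  by (intro card_image inj_on_subset[OF bij_is_inj[OF bij_row_shift]]) simp

lemma ran_row_shift_colored: "ran (row_shift_colored \<chi>) = ran \<chi>"
proof -
  have "range (\<chi> \<circ> inv row_shift) = range \<chi>"
    by (metis bij_imp_bij_inv bij_is_surj bij_row_shift image_comp)
  then show ?thesis
    unfolding ran_def row_shift_colored_def by (metis (mono_tags, opaque_lifting) rangeE rangeI)
qed

lemma n_coloring_row_shift_colored:
  "n_coloring n (row_shift ` S) (row_shift_colored \<chi>) \<longleftrightarrow> n_coloring n S \<chi>"
  by (simp add: n_coloring_def dom_row_shift_colored ran_row_shift_colored
      inj_image_eq_iff[OF bij_is_inj[OF bij_row_shift]])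

text \<open>The shift pushes the upper row of the square one step left; the translation then brings
  the lower row to height -1.\<close>

lemma Z_tetromino_eq: "Z_tetromino = translate (1, -1) (row_shift ` square_tetromino)"
  by (auto simp: Z_tetromino_def square_tetromino_def translate_def row_shift_def)

lemma translate_colored_row_shift_colored:
  "row_shift_colored (translate_colored v \<chi>) = translate_colored (row_shift v) (row_shift_colored \<chi>)"
proof
  fix d
  obtain c where d: "d = row_shift c"
    using bij_is_surj[OF bij_row_shift] by (metis surjD)
  have "row_shift c - row_shift v = row_shift (c - v)"
    by (metis add_diff_cancel diff_add_cancel row_shift_add)
  then show "row_shift_colored (translate_colored v \<chi>) d =
      translate_colored (row_shift v) (row_shift_colored \<chi>) d"
    by (simp add: d row_shift_colored_apply translate_colored_def)
qed

text \<open>By additivity, translation by \<open>v\<close> becomes translation by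
  \<open>row_shift v\<close>, and every vector has this form. This makes the shift well defined on
  translation classes.\<close>

lemma translation_rel_row_shift_colored:
  "(row_shift_colored \<chi>, row_shift_colored \<psi>) \<in> translation_rel \<longleftrightarrow> (\<chi>, \<psi>) \<in> translation_rel"
proof -
  have "(row_shift_colored \<chi>, row_shift_colored \<psi>) \<in> translation_rel \<longleftrightarrow>
      (\<exists>w. row_shift_colored \<psi> = translate_colored (row_shift w) (row_shift_colored \<chi>))"
    using bij_is_surj[OF bij_row_shift] unfolding translation_rel_def mem_Collect_eq case_prod_conv
    by (metis surjD)
  also have "\<dots> \<longleftrightarrow> (\<chi>, \<psi>) \<in> translation_rel"
    unfolding translation_rel_def translate_colored_row_shift_colored[symmetric]
      inj_eq[OF bij_is_inj[OF bij_row_shift_colored]] by simp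
  finally show ?thesis .
qed

lemma unique_windows_translate:
  "unique_windows (translate v p) n \<chi> \<longleftrightarrow> unique_windows p n \<chi>"
proof -
  have imp: "unique_windows p n \<chi>" if "unique_windows (translate v p) n \<chi>" for p v
    unfolding unique_windows_def
  proof (intro allI impI)
    fix \<kappa> assume "n_coloring n p \<kappa>"
    then have "n_coloring n (translate v p) (translate_colored v \<kappa>)"
      unfolding n_coloring_def dom_translate_colored
      by (auto simp: translate_colored_def ran_def simp del: split_paired_Ex)
    then have "\<exists>!w. \<forall>c\<in>translate v p. \<chi> (c + w) = translate_colored v \<kappa> c"
      using that unfolding unique_windows_def by blast
    then have *: "\<exists>!w. \<forall>c\<in>p. \<chi> (c + (v + w)) = \<kappa> c"
      by (simp add: translate_def translate_colored_def add.assoc)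
    then obtain w where w: "\<forall>c\<in>p. \<chi> (c + (v + w)) = \<kappa> c" by blast
    show "\<exists>!w. \<forall>c\<in>p. \<chi> (c + w) = \<kappa> c"
    proof (intro ex1I)
      show "\<forall>c\<in>p. \<chi> (c + (v + w)) = \<kappa> c" by (fact w)
      fix u assume "\<forall>c\<in>p. \<chi> (c + u) = \<kappa> c"
      then have "\<forall>c\<in>p. \<chi> (c + (v + (u - v))) = \<kappa> c" by simp
      then have "u - v = w" using * w by blast
      then show "u = v + w" by auto
    qed
  qed
  \<comment> \<open>The converse is the implication just shown, applied to the shape
    \<open>translate v p\<close> and the vector \<open>- v\<close>.\<close>
  have "translate (- v) (translate v p) = p"
    by (simp add: translate_def image_image add.assoc)
  then show ?thesis
    using imp by metis
qed

text \<open>Both quantifiers are reindexed, colorings by \<open>row_shift_colored\<close> and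
  positions by \<open>row_shift\<close>; additivity then removes the shift.\<close>

lemma unique_windows_row_shift:
  "unique_windows (row_shift ` p) n (row_shift_colored \<chi>) \<longleftrightarrow> unique_windows p n \<chi>"
proof -
  have all: "(\<forall>\<kappa>. P \<kappa>) \<longleftrightarrow> (\<forall>\<kappa>. P (row_shift_colored \<kappa>))" for P
    using bij_is_surj[OF bij_row_shift_colored] by (metis surjD)
  have "(\<exists>w. u = row_shift w \<and> P (row_shift w)) \<longleftrightarrow> P u" for P u
    using surjD[OF bij_is_surj[OF bij_row_shift], of u] by blast
  then have ex1: "(\<exists>!w. P w) \<longleftrightarrow> (\<exists>!w. P (row_shift w))" for P
    using ex1_image_iff[OF bij_is_inj[OF bij_row_shift], of "\<lambda>w. P (row_shift w)"] by simp
  have "unique_windows (row_shift ` p) n (row_shift_colored \<chi>) \<longleftrightarrow>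
      (\<forall>\<kappa>. n_coloring n (row_shift ` p) (row_shift_colored \<kappa>) \<longrightarrow>
        (\<exists>!w. \<forall>c\<in>row_shift ` p. row_shift_colored \<chi> (c + w) = row_shift_colored \<kappa> c))"
    unfolding unique_windows_def by (rule all)
  also have "\<dots> \<longleftrightarrow> (\<forall>\<kappa>. n_coloring n p \<kappa> \<longrightarrow>
        (\<exists>!w. \<forall>c\<in>p. row_shift_colored \<chi> (row_shift c + w) = \<kappa> c))"
    by (simp add: n_coloring_row_shift_colored row_shift_colored_apply)
  also have "\<dots> \<longleftrightarrow> (\<forall>\<kappa>. n_coloring n p \<kappa> \<longrightarrow>
        (\<exists>!w. \<forall>c\<in>p. row_shift_colored \<chi> (row_shift c + row_shift w) = \<kappa> c))"
    by (intro all_cong1 imp_cong refl ex1)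
  finally show ?thesis
    by (simp add: unique_windows_def row_shift_add[symmetric] row_shift_colored_apply)
qed

lemma unique_windows_Z_tetromino:
  "unique_windows Z_tetromino n (row_shift_colored \<chi>) \<longleftrightarrow> unique_windows square_tetromino n \<chi>"
  unfolding Z_tetromino_eq unique_windows_translate unique_windows_row_shift ..

section \<open>Connectedness\<close>

text \<open>Row ends may vary with the height so that rectangles and sheared rectangles are both
  covered. Paths run along a row to its left end and change rows at a common abscissa.\<close>

lemma edge_connected_stacked_rows:
  fixes l r :: "int \<Rightarrow> int" and s t :: int
  defines "S \<equiv> {(x, y). s \<le> y \<and> y \<le> t \<and> l y \<le> x \<and> x \<le> r y}"
  assumes overlap: "\<And>y. s \<le> y \<Longrightarrow> y < t \<Longrightarrow> \<exists>x. (x, y) \<in> S \<and> (x, y + 1) \<in> S"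
  shows "edge_connected S"
proof -
  define R where "R = {(a, b). a \<in> S \<and> b \<in> S \<and> adjacent a b}"
  have "sym R"
    unfolding R_def adjacent_def sym_def by (auto simp: abs_minus_commute)
  then have symR: "(b, a) \<in> R\<^sup>*" if "(a, b) \<in> R\<^sup>*" for a b
    using that sym_rtrancl symD by metis
  have row: "((l y, y), (x, y)) \<in> R\<^sup>*" if "(x, y) \<in> S" for x y
  proof -
    have "l y \<le> x" using that by (simp add: S_def)
    then show ?thesis using that
    proof (induction x rule: int_ge_induct)
      case (step x)
      then have "((x, y), (x + 1, y)) \<in> R"
        by (auto simp: R_def S_def adjacent_def)
      moreover have "(x, y) \<in> S" using step by (auto simp: S_def)
      ultimately show ?case using step.IH by (metis rtrancl.rtrancl_into_rtrancl)
    qed simp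
  qed
  have column: "((l s, s), (l y, y)) \<in> R\<^sup>*" if "s \<le> y" "y \<le> t" for y
    using that
  proof (induction y rule: int_ge_induct)
    case (step y)
    then obtain x where x: "(x, y) \<in> S" "(x, y + 1) \<in> S" using overlap[of y] by auto
    then have "((x, y), (x, y + 1)) \<in> R" by (auto simp: R_def adjacent_def)
    then have "((l y, y), (l (y + 1), y + 1)) \<in> R\<^sup>*"
      using row[OF x(1)] symR[OF row[OF x(2)]] by (meson r_into_rtrancl rtrancl_trans)
    moreover have "((l s, s), (l y, y)) \<in> R\<^sup>*" using step by simp
    ultimately show ?case by (rule rtrancl_trans[rotated])
  qed simp
  have "((l s, s), c) \<in> R\<^sup>*" if "c \<in> S" for c
    using that row[of "fst c" "snd c"] column[of "snd c"]
    by (cases c) (auto simp: S_def intro: rtrancl_trans)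
  then show ?thesis
    unfolding edge_connected_def R_def[symmetric] using symR by (meson rtrancl_trans)
qed

lemma edge_connected_rectangle:
  fixes a b c d :: int
  assumes "a < b"
  shows "edge_connected ({a..b} \<times> {c..d})"
proof -
  have "{a..b} \<times> {c..d} = {(x, y). c \<le> y \<and> y \<le> d \<and> a \<le> x \<and> x \<le> b}" by auto
  then show ?thesis
    using edge_connected_stacked_rows[of c d "\<lambda>_. a" "\<lambda>_. b"] assms by force
qed

lemma edge_connected_row_shift_rectangle:
  fixes a b c d :: int
  assumes "a < b"
  shows "edge_connected (row_shift ` ({a..b} \<times> {c..d}))"
proof -
  have "row_shift ` ({a..b} \<times> {c..d}) = {(x, y). c \<le> y \<and> y \<le> d \<and> a - y \<le> x \<and> x \<le> b - y}"
  proof (intro set_eqI iffI)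
    fix z assume "z \<in> {(x, y). c \<le> y \<and> y \<le> d \<and> a - y \<le> x \<and> x \<le> b - y}"
    then have "z = row_shift (fst z + snd z, snd z)" "(fst z + snd z, snd z) \<in> {a..b} \<times> {c..d}"
      by (auto simp: row_shift_def)
    then show "z \<in> row_shift ` ({a..b} \<times> {c..d})" by (rule image_eqI)
  qed (auto simp: row_shift_def)
  moreover have "\<exists>x. (x, y) \<in> {(x, y). c \<le> y \<and> y \<le> d \<and> a - y \<le> x \<and> x \<le> b - y} \<and>
      (x, y + 1) \<in> {(x, y). c \<le> y \<and> y \<le> d \<and> a - y \<le> x \<and> x \<le> b - y}"
    if "c \<le> y" "y < d" for y
    \<comment> \<open>The left end of row \<open>y\<close> still lies in row \<open>y + 1\<close>,
      which sits one step further left, because \<open>a < b\<close>.\<close>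
    using that assms by (intro exI[of _ "a - y"]) auto
  ultimately show ?thesis
    using edge_connected_stacked_rows[of c d "\<lambda>y. a - y" "\<lambda>y. b - y"] by simp
qed

section \<open>The isoperimetric bound\<close>

text \<open>In each occupied row, the cell to the right of the rightmost cell is new.\<close>

lemma card_Un_shift_right:
  fixes T :: "cell set"
  assumes "finite T"
  shows "card T + card (snd ` T) \<le> card (T \<union> (\<lambda>(x, y). (x + 1, y)) ` T)"
proof -
  define e where "e y = (Max {x. (x, y) \<in> T} + 1, y)" for y
  have fin: "finite {x. (x, y) \<in> T}" for y
    by (rule finite_subset[of _ "fst ` T"]) (use assms in \<open>force+\<close>)
  have "e y \<notin> T" for y
    using Max_ge[OF fin, of "Max {x. (x, y) \<in> T} + 1" y] unfolding e_def by auto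
  moreover have "e y \<in> (\<lambda>(x, y). (x + 1, y)) ` T" if "y \<in> snd ` T" for y
    using Max_in[OF fin, of y] that unfolding e_def by force
  ultimately have "e ` snd ` T \<subseteq> (\<lambda>(x, y). (x + 1, y)) ` T" "T \<inter> e ` snd ` T = {}" by blast+
  moreover have "card (e ` snd ` T) = card (snd ` T)"
    by (intro card_image) (auto simp: inj_on_def e_def)
  ultimately have "card T + card (snd ` T) = card (T \<union> e ` snd ` T)"
    using assms by (simp add: card_Un_disjoint)
  also have "\<dots> \<le> card (T \<union> (\<lambda>(x, y). (x + 1, y)) ` T)"
    using assms \<open>e ` snd ` T \<subseteq> _\<close> by (intro card_mono) auto
  finally show ?thesis .
qed

text \<open>The horizontal case, reflected by exchanging the coordinates.\<close>

lemma card_Un_shift_up: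
  fixes T :: "cell set"
  assumes "finite T"
  shows "card T + card (fst ` T) \<le> card (T \<union> (\<lambda>(x, y). (x, y + 1)) ` T)"
proof -
  have "prod.swap ` (T \<union> (\<lambda>(x, y). (x, y + 1)) ` T) =
      prod.swap ` T \<union> (\<lambda>(x, y). (x + 1, y)) ` prod.swap ` T"
    by (simp add: image_Un image_image split_beta)
  then have "card (T \<union> (\<lambda>(x, y). (x, y + 1)) ` T) =
      card (prod.swap ` T \<union> (\<lambda>(x, y). (x + 1, y)) ` prod.swap ` T)"
    by (metis card_image inj_swap)
  moreover have "snd ` prod.swap ` T = fst ` T" by (simp add: image_image)
  moreover have "card (prod.swap ` T) = card T" by (simp add: card_image)
  ultimately show ?thesis
    using card_Un_shift_right[of "prod.swap ` T"] assms by simp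
qed

text \<open>Widening to the right occupies at least one more column, which is the source of the
  final \<open>+ 1\<close> in the bound.\<close>

lemma card_Un_succ:
  fixes X :: "int set"
  assumes "finite X" "X \<noteq> {}"
  shows "card X + 1 \<le> card (X \<union> (\<lambda>x. x + 1) ` X)"
proof -
  have "Max X + 1 \<notin> X" using Max_ge[OF assms(1), of "Max X + 1"] by auto
  then have "card X + 1 = card (insert (Max X + 1) X)" using assms by simp
  also have "\<dots> \<le> card (X \<union> (\<lambda>x. x + 1) ` X)"
    using assms Max_in[OF assms] by (intro card_mono) auto
  finally show ?thesis .
qed

text \<open>Each element without successor in \<open>X\<close> contributes a new point. The maximum
  always does, so a single new point excludes gaps.\<close>

lemma Un_succ_eq_interval:
  fixes X :: "int set"
  assumes "finite X" "X \<noteq> {}" and card: "card (X \<union> (\<lambda>x. x + 1) ` X) \<le> card X + 1"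
  shows "\<exists>a b. a < b \<and> X \<union> (\<lambda>x. x + 1) ` X = {a..b}"
proof -
  define a where "a = Min X"
  define b where "b = Max X"
  have a: "a \<in> X" "\<And>x. x \<in> X \<Longrightarrow> a \<le> x"
    using assms by (simp_all add: a_def)
  have b: "b \<in> X" "\<And>x. x \<in> X \<Longrightarrow> x \<le> b"
    using assms by (simp_all add: b_def)
  have "b + 1 \<notin> X" using b(2)[of "b + 1"] by auto
  have succ: "x + 1 \<in> X" if "x \<in> X" "x \<noteq> b" for x
  proof (rule ccontr)
    assume "x + 1 \<notin> X"
    then have "card X + 2 = card (insert (x + 1) (insert (b + 1) X))"
      using \<open>b + 1 \<notin> X\<close> that assms by simp
    also have "\<dots> \<le> card (X \<union> (\<lambda>x. x + 1) ` X)"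
      using assms(1) b(1) that(1) by (intro card_mono) auto
    finally show False using card by simp
  qed
  have mem: "x \<in> X" if "a \<le> x" "x \<le> b" for x
    using that
  proof (induction x rule: int_ge_induct)
    case (step x)
    then show ?case using succ[of x] by simp
  qed (use a(1) in simp)
  have X: "X = {a..b}"
    by (intro set_eqI iffI) (simp_all add: a b mem)
  have "a \<le> b" using a(2)[OF b(1)] .
  then have "{a..b} \<union> (\<lambda>x. x + 1) ` {a..b} = {a..b + 1}"
    by auto
  then show ?thesis
    using \<open>a \<le> b\<close> unfolding X by (intro exI[of _ a] exI[of _ "b + 1"]) simp
qed

text \<open>The inequality of arithmetic and geometric means with its equality case, from
  \<open>(r + c)\<^sup>2 = (r - c)\<^sup>2 + 4 * r * c\<close> over the integers.\<close>

lemma double_le_sum_if_square_le_prod: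
  fixes m r c :: nat
  assumes "m\<^sup>2 \<le> r * c"
  shows "2 * m \<le> r + c" and "r + c \<le> 2 * m \<Longrightarrow> r = m \<and> c = m"
proof -
  have sq: "(int r + int c)\<^sup>2 = (int r - int c)\<^sup>2 + 4 * int (r * c)"
    by (simp add: power2_eq_square algebra_simps)
  have m: "int m ^ 2 \<le> int (r * c)" using assms by (metis of_nat_le_iff of_nat_power)
  have "(2 * int m)\<^sup>2 = 4 * (int m)\<^sup>2" by (simp add: power_mult_distrib)
  then have "(2 * int m)\<^sup>2 \<le> (int r + int c)\<^sup>2"
    using sq m zero_le_power2[of "int r - int c"] by linarith
  then have "2 * int m \<le> int r + int c" by (rule power2_le_imp_le) simp
  then show le: "2 * m \<le> r + c" by linarith
  assume "r + c \<le> 2 * m"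
  then have "int r + int c = 2 * int m" using le by linarith
  then have "(int r - int c)\<^sup>2 = 4 * (int m)\<^sup>2 - 4 * int (r * c)"
    using sq by (simp add: power_mult_distrib)
  then have "(int r - int c)\<^sup>2 \<le> 0" using m by linarith
  then show "r = m \<and> c = m" using \<open>int r + int c = 2 * int m\<close> by simp
qed

lemma square_windows_isoperimetry:
  fixes S T :: "cell set"
  assumes "finite S" "m > 0" "m\<^sup>2 \<le> card T"
    and windows: "\<And>v. v \<in> T \<Longrightarrow> translate v square_tetromino \<subseteq> S"
  shows "(m + 1)\<^sup>2 \<le> card S"
    and "card S = (m + 1)\<^sup>2 \<Longrightarrow> \<exists>a b c d. a < b \<and> c < d \<and> S = {a..b} \<times> {c..d}"
proof -
  define X where "X = fst ` T"
  define Y where "Y = snd ` T"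
  define X' where "X' = X \<union> (\<lambda>x. x + 1) ` X"
  define Y' where "Y' = Y \<union> (\<lambda>y. y + 1) ` Y"
  define H where "H = T \<union> (\<lambda>(x, y). (x + 1, y)) ` T"
  have win: "(x, y) \<in> S \<and> (x + 1, y) \<in> S \<and> (x, y + 1) \<in> S \<and> (x + 1, y + 1) \<in> S"
    if "(x, y) \<in> T" for x y
    using windows[OF that] by (auto simp: translate_def square_tetromino_def add.commute)
  have "T \<subseteq> S" using win by auto
  then have finT: "finite T" using assms(1) finite_subset by blast
  have "T \<noteq> {}" using assms(2,3) by auto
  then have ne: "X \<noteq> {}" "Y \<noteq> {}" and fin: "finite X" "finite Y" "finite H"
    using finT by (auto simp: X_def Y_def H_def)
  have "T \<subseteq> X \<times> Y" by (force simp: X_def Y_def)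
  then have TXY: "card T \<le> card X * card Y"
    using fin by (metis card_mono card_cartesian_product finite_cartesian_product)
  have "fst ` H = X'" by (simp add: H_def X_def X'_def image_Un image_image split_beta)
  have "H \<union> (\<lambda>(x, y). (x, y + 1)) ` H \<subseteq> S" using win by (auto simp: H_def)
  then have "card (H \<union> (\<lambda>(x, y). (x, y + 1)) ` H) \<le> card S" using assms(1) by (rule card_mono[rotated])
  \<comment> \<open>Passing from \<open>T\<close> to \<open>H\<close> costs \<open>card Y\<close>
    cells; adding the upper neighbours of \<open>H\<close> costs one per column of \<open>H\<close>,
    and these columns form \<open>X'\<close>.\<close>
  then have S: "card T + card Y + card X + 1 \<le> card S"
    using card_Un_shift_right[OF finT] card_Un_shift_up[OF fin(3)] card_Un_succ[OF fin(1) ne(1)]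
      \<open>fst ` H = X'\<close>
    by (simp add: H_def X'_def Y_def)
  have mm: "m\<^sup>2 \<le> card X * card Y" using TXY assms(3) by linarith
  note XY = double_le_sum_if_square_le_prod[OF mm]
  have sq: "(m + 1)\<^sup>2 = m\<^sup>2 + 2 * m + 1" by (simp add: power2_eq_square)
  show "(m + 1)\<^sup>2 \<le> card S" using S XY(1) assms(3) sq by linarith
  assume card: "card S = (m + 1)\<^sup>2"
  \<comment> \<open>Equality leaves at most \<open>2 * m\<close> for \<open>card X + card Y\<close>,
    so the equality case of the means applies and \<open>T\<close> fills
    \<open>X \<times> Y\<close>.\<close>
  then have "card X = m" "card Y = m" using S XY(2) assms(3) sq by simp_all
  then have "T = X \<times> Y"
    using \<open>T \<subseteq> X \<times> Y\<close> assms(3) fin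
    by (intro card_seteq) (auto simp: card_cartesian_product power2_eq_square)
  then have "X' \<times> Y' \<subseteq> S"
    using win by (auto simp: X'_def Y'_def)
  have X': "m + 1 \<le> card X'" and Y': "m + 1 \<le> card Y'"
    using card_Un_succ fin ne \<open>card X = m\<close> \<open>card Y = m\<close> by (metis X'_def, metis Y'_def)
  \<comment> \<open>Both factors are at least \<open>m + 1\<close> and the product fits into
    \<open>S\<close>, so both equal \<open>m + 1\<close>; hence \<open>X'\<close> and
    \<open>Y'\<close> are intervals.\<close>
  have le: "card X' * card Y' \<le> (m + 1) * (m + 1)"
    using card_mono[OF assms(1) \<open>X' \<times> Y' \<subseteq> S\<close>] card
    by (simp add: card_cartesian_product power2_eq_square)
  have "card X' \<le> m + 1"
  proof (rule ccontr)
    assume "\<not> ?thesis"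
    then have "(m + 1) * (m + 1) < card X' * card Y'"
      using Y' by (intro mult_less_le_imp_less) auto
    then show False using le by simp
  qed
  moreover have "card Y' \<le> m + 1"
  proof (rule ccontr)
    assume "\<not> ?thesis"
    then have "(m + 1) * (m + 1) < card X' * card Y'"
      using X' by (intro mult_le_less_imp_less) auto
    then show False using le by simp
  qed
  ultimately obtain a b c d where ab: "a < b" "X' = {a..b}" and cd: "c < d" "Y' = {c..d}"
    using Un_succ_eq_interval[OF fin(1) ne(1)] Un_succ_eq_interval[OF fin(2) ne(2)]
      \<open>card X = m\<close> \<open>card Y = m\<close> unfolding X'_def Y'_def by metis
  have "card (X' \<times> Y') = card S"
    using X' Y' \<open>card X' \<le> m + 1\<close> \<open>card Y' \<le> m + 1\<close> card
    by (simp add: card_cartesian_product power2_eq_square)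
  then have "S = X' \<times> Y'"
    using card_subset_eq[OF assms(1) \<open>X' \<times> Y' \<subseteq> S\<close>] by simp
  then show "\<exists>a b c d. a < b \<and> c < d \<and> S = {a..b} \<times> {c..d}"
    using ab cd by blast
qed

section \<open>Colorings of the square tetromino and the number of its windows\<close>

definition square_coloring :: "nat \<Rightarrow> nat \<Rightarrow> nat \<Rightarrow> nat \<Rightarrow> colored_set" where
  "square_coloring a b c d = [(0, 0) \<mapsto> a, (0, 1) \<mapsto> b, (1, 0) \<mapsto> c, (1, 1) \<mapsto> d]"

lemma n_coloring_square_iff:
  "n_coloring n square_tetromino \<kappa> \<longleftrightarrow>
    (\<exists>a b c d. {a, b, c, d} \<subseteq> {1..n} \<and> \<kappa> = square_coloring a b c d)"
proof
  assume L: "n_coloring n square_tetromino \<kappa>"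
  then have dom: "dom \<kappa> = square_tetromino" and ran: "ran \<kappa> \<subseteq> {1..n}"
    by (simp_all add: n_coloring_def)
  have "(0, 0) \<in> dom \<kappa>" "(0, 1) \<in> dom \<kappa>" "(1, 0) \<in> dom \<kappa>" "(1, 1) \<in> dom \<kappa>"
    unfolding dom by (auto simp: square_tetromino_def)
  then obtain a b c d where \<kappa>: "\<kappa> (0, 0) = Some a" "\<kappa> (0, 1) = Some b" "\<kappa> (1, 0) = Some c"
    "\<kappa> (1, 1) = Some d" by blast
  then have "{a, b, c, d} \<subseteq> {1..n}" using ran ranI[of \<kappa>] \<kappa> by blast
  moreover have "\<kappa> = square_coloring a b c d"
  proof
    fix z show "\<kappa> z = square_coloring a b c d z"
    proof (cases "z \<in> square_tetromino")
      case True
      then show ?thesis using \<kappa> by (auto simp: square_tetromino_def square_coloring_def)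
    next
      case False
      then have "\<kappa> z = None" using dom by blast
      then show ?thesis using False by (auto simp: square_tetromino_def square_coloring_def)
    qed
  qed
  ultimately show "\<exists>a b c d. {a, b, c, d} \<subseteq> {1..n} \<and> \<kappa> = square_coloring a b c d" by blast
next
  assume "\<exists>a b c d. {a, b, c, d} \<subseteq> {1..n} \<and> \<kappa> = square_coloring a b c d"
  then obtain a b c d where abcd: "{a, b, c, d} \<subseteq> {1..n}" and \<kappa>: "\<kappa> = square_coloring a b c d"
    by blast
  have "dom \<kappa> = square_tetromino"
    by (auto simp: \<kappa> square_coloring_def square_tetromino_def)
  moreover have "ran \<kappa> \<subseteq> {a, b, c, d}"
    by (simp add: \<kappa> square_coloring_def)
  ultimately show "n_coloring n square_tetromino \<kappa>"
    using abcd unfolding n_coloring_def by blast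
qed

text \<open>Colors are listed column by column, bottom to top, so that \<open>a\<close>,
  \<open>b\<close> and \<open>a'\<close>, \<open>b'\<close> are consecutive pairs in two adjacent
  columns.\<close>

lemma square_window_iff:
  "(\<forall>c\<in>square_tetromino. \<chi> (c + (x, y)) = square_coloring a b a' b' c) \<longleftrightarrow>
    \<chi> (x, y) = Some a \<and> \<chi> (x, y + 1) = Some b \<and>
    \<chi> (x + 1, y) = Some a' \<and> \<chi> (x + 1, y + 1) = Some b'"
  by (auto simp: square_tetromino_def square_coloring_def add.commute)

text \<open>Reading off the colors maps the window positions onto all quadruples. The count is
  written as a square to serve as \<open>m\<^sup>2\<close> with
  \<open>m = n\<^sup>2\<close>.\<close>

lemma card_square_windows:
  assumes "unique_windows square_tetromino n \<chi>" "finite (dom \<chi>)"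
  shows "(n\<^sup>2)\<^sup>2 \<le> card {v. translate v square_tetromino \<subseteq> dom \<chi>}"
proof -
  define W where "W = {v. translate v square_tetromino \<subseteq> dom \<chi>}"
  define colors where "colors v =
    (the (\<chi> v), the (\<chi> (v + (0, 1))), the (\<chi> (v + (1, 0))), the (\<chi> (v + (1, 1))))" for v
  have "W \<subseteq> dom \<chi>"
    by (auto simp: W_def translate_def square_tetromino_def)
  then have "finite W" using assms(2) finite_subset by blast
  have "{1..n} \<times> {1..n} \<times> {1..n} \<times> {1..n} \<subseteq> colors ` W"
  proof clarify
    fix a b c d assume "a \<in> {1..n}" "b \<in> {1..n}" "c \<in> {1..n}" "d \<in> {1..n}"
    then have "n_coloring n square_tetromino (square_coloring a b c d)"
      unfolding n_coloring_square_iff by blast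
    then obtain x y where
      v: "\<forall>e\<in>square_tetromino. \<chi> (e + (x, y)) = square_coloring a b c d e"
      using assms(1) unfolding unique_windows_def by (metis surj_pair)
    then have "(a, b, c, d) = colors (x, y)"
      unfolding square_window_iff colors_def by simp
    moreover have "(x, y) \<in> W"
      using v unfolding square_window_iff W_def
      by (auto simp: translate_def square_tetromino_def add.commute)
    ultimately show "(a, b, c, d) \<in> colors ` W" by blast
  qed
  then have "card ({1..n} \<times> {1..n} \<times> {1..n} \<times> {1..n}) \<le> card W"
    using \<open>finite W\<close> by (rule surj_card_le[rotated])
  then show ?thesis
    by (simp add: card_cartesian_product W_def power2_eq_square mult.assoc)
qed

section \<open>A colored square attaining the bound\<close>

text \<open>The pairs of consecutive terms with indices in \<open>k\<^sup>2, \<dots>, k\<^sup>2 + 2 * k\<close> are exactly the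
  pairs with maximum \<open>k\<close>: this block reads \<open>0, k, 1, k, \<dots>, k - 1, k, k\<close> and the next one starts
  with \<open>0\<close>. So for every \<open>n\<close> the first \<open>n\<^sup>2\<close> terms form a cyclic de Bruijn sequence of order 2.\<close>

definition db_seq :: "nat \<Rightarrow> nat" where
  "db_seq u = (let k = floor_sqrt u; t = u - k\<^sup>2 in if odd t \<or> t = 2 * k then k else t div 2)"

lemma db_seq_block:
  assumes "t \<le> 2 * k"
  shows "db_seq (k\<^sup>2 + t) = (if odd t \<or> t = 2 * k then k else t div 2)"
proof -
  have "floor_sqrt (k\<^sup>2 + t) = k"
    by (rule floor_sqrt_unique) (use assms in \<open>auto simp: power2_eq_square\<close>)
  then show ?thesis unfolding db_seq_def Let_def by (metis add_diff_cancel_left')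
qed

lemma db_seq_square: "db_seq (k\<^sup>2) = 0"
  using db_seq_block[of 0 k] by auto

text \<open>For \<open>a < b\<close> the pair sits in block \<open>b\<close> at offset
  \<open>2 * a\<close>; for \<open>b = 0\<close> it straddles the end of block \<open>a\<close>;
  otherwise it is in block \<open>a\<close> at offset \<open>2 * b - 1\<close>.\<close>

lemma db_seq_pair_exists:
  assumes "a < n" "b < n"
  shows "\<exists>u<n\<^sup>2. db_seq u = a \<and> db_seq (Suc u) = b"
proof -
  have less: "k\<^sup>2 + t < n\<^sup>2" if "t \<le> 2 * k" "k < n" for k t
  proof -
    have "k\<^sup>2 + t < (Suc k)\<^sup>2" using that by (simp add: power2_eq_square)
    also have "\<dots> \<le> n\<^sup>2" using that by (intro power_mono) auto
    finally show ?thesis .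
  qed
  consider "a < b" | "b = 0" | "0 < b" "b \<le> a" by linarith
  then show ?thesis
  proof cases
    case 1
    then show ?thesis
      using db_seq_block[of "2 * a" b] db_seq_block[of "Suc (2 * a)" b] less[of "2 * a" b] assms
      by (intro exI[of _ "b\<^sup>2 + 2 * a"]) auto
  next
    case 2
    have "Suc (a\<^sup>2 + 2 * a) = (Suc a)\<^sup>2" by (simp add: power2_eq_square)
    then show ?thesis
      using 2 db_seq_block[of "2 * a" a] db_seq_square[of "Suc a"] less[of "2 * a" a] assms
      by (intro exI[of _ "a\<^sup>2 + 2 * a"]) auto
  next
    case 3
    then obtain c where c: "b = Suc c" using gr0_conv_Suc by blast
    have "db_seq (Suc (a\<^sup>2 + Suc (2 * c))) = b"
      using db_seq_block[of "2 * b" a] 3 c by auto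
    then show ?thesis
      using 3 c db_seq_block[of "Suc (2 * c)" a] less[of "Suc (2 * c)" a] assms
      by (intro exI[of _ "a\<^sup>2 + Suc (2 * c)"]) auto
  qed
qed

text \<open>Counting: \<open>n\<^sup>2\<close> indices already yield all \<open>n\<^sup>2\<close>
  pairs, hence no other pair and none twice.\<close>

lemma
  shows db_seq_less: "u < n\<^sup>2 \<Longrightarrow> db_seq u < n"
    and db_seq_pair_inj:
      "u < n\<^sup>2 \<Longrightarrow> v < n\<^sup>2 \<Longrightarrow> db_seq u = db_seq v \<Longrightarrow> db_seq (Suc u) = db_seq (Suc v) \<Longrightarrow> u = v"
proof -
  define g where "g u = (db_seq u, db_seq (Suc u))" for u
  have sub: "{..<n} \<times> {..<n} \<subseteq> g ` {..<n\<^sup>2}"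
    using db_seq_pair_exists unfolding g_def by fast
  have card: "card ({..<n} \<times> {..<n}) = n\<^sup>2" by (simp add: card_cartesian_product power2_eq_square)
  have "card (g ` {..<n\<^sup>2}) \<le> n\<^sup>2"
    using card_image_le[of "{..<n\<^sup>2}" g] by simp
  then have eq: "g ` {..<n\<^sup>2} = {..<n} \<times> {..<n}"
    using card_seteq[OF _ sub] card by simp
  then have inj: "inj_on g {..<n\<^sup>2}"
    using card by (intro eq_card_imp_inj_on) simp_all
  show "db_seq u < n" if "u < n\<^sup>2"
    using eq that unfolding g_def by blast
  show "u = v" if "u < n\<^sup>2" "v < n\<^sup>2" "db_seq u = db_seq v" "db_seq (Suc u) = db_seq (Suc v)"
    using inj_onD[OF inj, of u v] that by (simp add: g_def)
qed

definition cyc_seq :: "nat \<Rightarrow> int \<Rightarrow> nat" where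
  "cyc_seq n z = db_seq (nat (z mod int (n\<^sup>2)))"

text \<open>At the wrap-around, \<open>db_seq (n\<^sup>2)\<close> and \<open>db_seq 0\<close> are
  both 0, so the infinite sequence agrees with the cyclic one for one step past the period.\<close>

lemma cyc_seq_succ:
  assumes "n > 0"
  shows "cyc_seq n (z + 1) = db_seq (Suc (nat (z mod int (n\<^sup>2))))"
proof -
  define m where "m = int (n\<^sup>2)"
  have "m > 0" using assms by (simp add: m_def)
  then have z: "0 \<le> z mod m" "z mod m < m" by simp_all
  have Suc: "Suc (nat (z mod m)) = nat (z mod m + 1)" using z by simp
  have mod: "(z + 1) mod m = (z mod m + 1) mod m" by (simp add: mod_add_left_eq)
  show ?thesis
  proof (cases "z mod m + 1 = m")
    case True
    then have "nat (z mod m + 1) = n\<^sup>2" by (simp only: m_def nat_int)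
    then show ?thesis
      using True mod Suc db_seq_square[of n] db_seq_square[of 0]
      unfolding cyc_seq_def m_def[symmetric] by simp
  next
    case False
    then have "(z + 1) mod m = z mod m + 1" using z mod by simp
    then show ?thesis using Suc unfolding cyc_seq_def m_def[symmetric] by simp
  qed
qed

text \<open>Two consecutive terms locate a position modulo the period, which turns color conditions
  into congruences.\<close>

lemma cyc_seq_pair_iff:
  assumes "n > 0" "a < n" "b < n"
  shows "\<exists>u. \<forall>z. cyc_seq n z = a \<and> cyc_seq n (z + 1) = b \<longleftrightarrow> [z = u] (mod int (n\<^sup>2))"
proof -
  obtain u where u: "u < n\<^sup>2" "db_seq u = a" "db_seq (Suc u) = b"
    using db_seq_pair_exists assms by blast
  have "cyc_seq n z = a \<and> cyc_seq n (z + 1) = b \<longleftrightarrow> [z = int u] (mod int (n\<^sup>2))" for z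
  proof -
    have "nat (z mod int (n\<^sup>2)) < n\<^sup>2"
      using assms(1) by (subst nat_less_iff) auto
    then have "cyc_seq n z = a \<and> cyc_seq n (z + 1) = b \<longleftrightarrow> nat (z mod int (n\<^sup>2)) = u"
      unfolding cyc_seq_succ[OF assms(1)] unfolding cyc_seq_def
      using u db_seq_pair_inj by metis
    also have "\<dots> \<longleftrightarrow> [z = int u] (mod int (n\<^sup>2))"
      using u(1) assms(1) unfolding cong_def by (auto simp flip: of_nat_mod)
    finally show ?thesis .
  qed
  then show ?thesis by blast
qed

lemma cong_unique_in_range:
  fixes m u :: int
  assumes "m > 0"
  shows "\<exists>!z. 0 \<le> z \<and> z < m \<and> [z = u] (mod m)"
  using assms by (intro ex1I[of _ "u mod m"]) (auto simp: cong_def)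

text \<open>Column \<open>x\<close> is the cyclic sequence shifted by \<open>x * (x - 1) div 2\<close>, so relative to column \<open>x\<close>
  the column \<open>x + 1\<close> is shifted by \<open>x\<close>. The four colors of a window determine the two positions in
  the cyclic sequence, their difference determines \<open>x\<close>, and then \<open>y\<close> is determined.\<close>

lemma square_windows_attained:
  assumes "n > 0"
  shows "\<exists>\<chi>. n_coloring n (dom \<chi>) \<chi> \<and> unique_windows square_tetromino n \<chi> \<and>
    card (dom \<chi>) = (n\<^sup>2 + 1)\<^sup>2"
proof -
  define m where "m = int (n\<^sup>2)"
  have "m > 0" using assms by (simp add: m_def)
  define tri where "tri x = x * (x - 1) div 2" for x :: int
  have tri: "tri (x + 1) = tri x + x" for x
  proof -
    have "(x + 1) * (x + 1 - 1) = x * (x - 1) + x * 2" by (simp add: algebra_simps)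
    then show ?thesis unfolding tri_def by simp
  qed
  \<comment> \<open>The side has \<open>m + 1\<close> cells, so windows start at \<open>m\<close>
    values of each coordinate; \<open>Suc\<close> moves the colors from 0-based to 1-based.\<close>
  define \<chi> :: colored_set where "\<chi> = (\<lambda>(x, y). if 0 \<le> x \<and> x \<le> m \<and> 0 \<le> y \<and> y \<le> m
    then Some (Suc (cyc_seq n (y + tri x))) else None)"
  have dom: "dom \<chi> = {0..m} \<times> {0..m}"
    by (auto simp: \<chi>_def dom_def split: if_splits)
  have "cyc_seq n z < n" for z
    unfolding cyc_seq_def using assms by (intro db_seq_less) (auto simp: nat_less_iff)
  then have "n_coloring n (dom \<chi>) \<chi>"
    by (auto simp: n_coloring_def ran_def \<chi>_def Suc_le_eq split: if_splits)
  moreover have "unique_windows square_tetromino n \<chi>"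
    unfolding unique_windows_def n_coloring_square_iff
  proof clarify
    fix a b c d assume "{a, b, c, d} \<subseteq> {1..n}"
    then have pos: "a > 0" "b > 0" "c > 0" "d > 0"
      and less: "a - 1 < n" "b - 1 < n" "c - 1 < n" "d - 1 < n" by auto
    obtain u where u: "\<And>z. cyc_seq n z = a - 1 \<and> cyc_seq n (z + 1) = b - 1 \<longleftrightarrow> [z = u] (mod m)"
      using cyc_seq_pair_iff[OF assms less(1,2)] unfolding m_def by blast
    obtain v where v: "\<And>z. cyc_seq n z = c - 1 \<and> cyc_seq n (z + 1) = d - 1 \<longleftrightarrow> [z = v] (mod m)"
      using cyc_seq_pair_iff[OF assms less(3,4)] unfolding m_def by blast
    have iff: "(\<forall>e\<in>square_tetromino. \<chi> (e + (x, y)) = square_coloring a b c d e) \<longleftrightarrow>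
        (0 \<le> x \<and> x < m \<and> [x = v - u] (mod m)) \<and> (0 \<le> y \<and> y < m \<and> [y = u - tri x] (mod m))" for x y
    proof -
      \<comment> \<open>Colors are positive, so \<open>Suc\<close> can be undone by subtracting 1;
        the bounds for the four cells combine to those on \<open>x\<close> and
        \<open>y\<close>.\<close>
      have "(\<forall>e\<in>square_tetromino. \<chi> (e + (x, y)) = square_coloring a b c d e) \<longleftrightarrow>
          (0 \<le> x \<and> x < m \<and> 0 \<le> y \<and> y < m) \<and>
          (cyc_seq n (y + tri x) = a - 1 \<and> cyc_seq n (y + tri x + 1) = b - 1) \<and>
          (cyc_seq n (y + tri (x + 1)) = c - 1 \<and> cyc_seq n (y + tri (x + 1) + 1) = d - 1)"
        unfolding square_window_iff \<chi>_def using pos by (auto simp: ac_simps)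
      also have "\<dots> \<longleftrightarrow> (0 \<le> x \<and> x < m \<and> 0 \<le> y \<and> y < m) \<and>
          [y + tri x = u] (mod m) \<and> [y + tri x + x = v] (mod m)"
        unfolding u v tri by (simp add: add.assoc)
      also have "[y + tri x = u] (mod m) \<and> [y + tri x + x = v] (mod m) \<longleftrightarrow>
          [x = v - u] (mod m) \<and> [y = u - tri x] (mod m)"
      proof -
        have "[y + tri x = u] (mod m) \<longleftrightarrow> [y = u - tri x] (mod m)"
          by (simp add: cong_iff_dvd_diff algebra_simps)
        moreover have "[y + tri x + x = v] (mod m) \<longleftrightarrow> [x = v - u] (mod m)"
          if "[y + tri x = u] (mod m)"
        proof -
          have "[y + tri x + x = u + x] (mod m)" using that by (intro cong_add) auto
          then have "[y + tri x + x = v] (mod m) \<longleftrightarrow> [u + x = v] (mod m)"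
            using cong_trans cong_sym by blast
          also have "\<dots> \<longleftrightarrow> [x = v - u] (mod m)"
            by (simp add: cong_iff_dvd_diff algebra_simps)
          finally show ?thesis .
        qed
        ultimately show ?thesis by blast
      qed
      finally show ?thesis by blast
    qed
    obtain x where x: "0 \<le> x \<and> x < m \<and> [x = v - u] (mod m)"
      "\<And>x'. 0 \<le> x' \<and> x' < m \<and> [x' = v - u] (mod m) \<Longrightarrow> x' = x"
      using cong_unique_in_range[OF \<open>m > 0\<close>, of "v - u"] by metis
    \<comment> \<open>The congruence for \<open>y\<close> involves \<open>tri x\<close>, so it is
      solved after \<open>x\<close> is fixed.\<close>
    obtain y where y: "0 \<le> y \<and> y < m \<and> [y = u - tri x] (mod m)"
      "\<And>y'. 0 \<le> y' \<and> y' < m \<and> [y' = u - tri x] (mod m) \<Longrightarrow> y' = y"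
      using cong_unique_in_range[OF \<open>m > 0\<close>, of "u - tri x"] by metis
    show "\<exists>!w. \<forall>e\<in>square_tetromino. \<chi> (e + w) = square_coloring a b c d e"
    proof (rule ex1I[of _ "(x, y)"])
      show "\<forall>e\<in>square_tetromino. \<chi> (e + (x, y)) = square_coloring a b c d e"
        using x(1) y(1) unfolding iff by blast
      fix w assume w: "\<forall>e\<in>square_tetromino. \<chi> (e + w) = square_coloring a b c d e"
      then show "w = (x, y)"
        using iff[of "fst w" "snd w"] x(2) y(2) by (metis prod.collapse)
    qed
  qed
  moreover have "card (dom \<chi>) = (n\<^sup>2 + 1)\<^sup>2"
  proof -
    have "card {0..m} = n\<^sup>2 + 1" unfolding card_atLeastAtMost_int by (simp add: m_def nat_eq_iff)
    then show ?thesis unfolding dom card_cartesian_product power2_eq_square[of "n\<^sup>2 + 1"] by simp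
  qed
  ultimately show ?thesis by blast
qed

section \<open>Prismatic polyominoes\<close>

text \<open>The isoperimetric bound for \<open>m = n\<^sup>2\<close>, with all window positions as
  \<open>T\<close>.\<close>

lemma square_windows_bound:
  assumes "n > 0" "unique_windows square_tetromino n \<chi>" "finite (dom \<chi>)"
  shows "(n\<^sup>2 + 1)\<^sup>2 \<le> card (dom \<chi>)"
    and "card (dom \<chi>) = (n\<^sup>2 + 1)\<^sup>2 \<Longrightarrow> \<exists>a b c d. a < b \<and> c < d \<and> dom \<chi> = {a..b} \<times> {c..d}"
  using square_windows_isoperimetry[OF assms(3) _ card_square_windows[OF assms(2,3)]] assms(1)
  by simp_all

lemma prismatic_square_iff:
  assumes "n > 0"
  shows "prismatic_polyomino square_tetromino n \<chi> \<longleftrightarrow> n_coloring n (dom \<chi>) \<chi> \<and>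
    unique_windows square_tetromino n \<chi> \<and> card (dom \<chi>) = (n\<^sup>2 + 1)\<^sup>2"
proof (rule prismatic_polyomino_iff)
  fix \<psi> assume \<psi>: "unique_windows square_tetromino n \<psi>" "card (dom \<psi>) = (n\<^sup>2 + 1)\<^sup>2"
  then have "finite (dom \<psi>)" by (intro card_ge_0_finite) simp
  then show "edge_connected (dom \<psi>)"
    using square_windows_bound(2)[OF assms \<psi>(1)] \<psi>(2) edge_connected_rectangle by metis
qed (use square_windows_attained square_windows_bound assms in
      \<open>auto simp: square_tetromino_def\<close>)

text \<open>Every colored set is a row shift, so attainment and bound are pulled back to the square.
  The extremal sets are sheared rectangles, which are still connected.\<close>

lemma prismatic_Z_iff:
  assumes "n > 0"
  shows "prismatic_polyomino Z_tetromino n \<chi> \<longleftrightarrow> n_coloring n (dom \<chi>) \<chi> \<and>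
    unique_windows Z_tetromino n \<chi> \<and> card (dom \<chi>) = (n\<^sup>2 + 1)\<^sup>2"
proof (rule prismatic_polyomino_iff)
  show "\<exists>\<psi>. n_coloring n (dom \<psi>) \<psi> \<and> unique_windows Z_tetromino n \<psi> \<and>
      card (dom \<psi>) = (n\<^sup>2 + 1)\<^sup>2"
  proof -
    obtain \<phi> where "n_coloring n (dom \<phi>) \<phi> \<and> unique_windows square_tetromino n \<phi> \<and>
        card (dom \<phi>) = (n\<^sup>2 + 1)\<^sup>2"
      using square_windows_attained[OF assms] by blast
    then show ?thesis
      by (intro exI[of _ "row_shift_colored \<phi>"])
        (simp only: n_coloring_row_shift_colored unique_windows_Z_tetromino
          card_dom_row_shift_colored, simp only: dom_row_shift_colored n_coloring_row_shift_colored)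
  qed
next
  fix \<psi> assume \<psi>: "unique_windows Z_tetromino n \<psi>" "finite (dom \<psi>)"
  obtain \<phi> where \<phi>: "\<psi> = row_shift_colored \<phi>"
    using bij_is_surj[OF bij_row_shift_colored] by (metis surjD)
  then have "finite (dom \<phi>)"
    using \<psi>(2) bij_is_inj[OF bij_row_shift]
    by (metis dom_row_shift_colored finite_imageD inj_on_subset subset_UNIV)
  then show "(n\<^sup>2 + 1)\<^sup>2 \<le> card (dom \<psi>)"
    using square_windows_bound(1)[OF assms] \<psi>(1) unfolding \<phi>
    by (simp add: card_dom_row_shift_colored unique_windows_Z_tetromino)
next
  fix \<psi> assume \<psi>: "unique_windows Z_tetromino n \<psi>" "card (dom \<psi>) = (n\<^sup>2 + 1)\<^sup>2"
  obtain \<phi> where \<phi>: "\<psi> = row_shift_colored \<phi>"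
    using bij_is_surj[OF bij_row_shift_colored] by (metis surjD)
  have card: "card (dom \<phi>) = (n\<^sup>2 + 1)\<^sup>2"
    using \<psi>(2) by (simp add: \<phi> card_dom_row_shift_colored)
  then have "finite (dom \<phi>)" by (intro card_ge_0_finite) simp
  then show "edge_connected (dom \<psi>)"
    using square_windows_bound(2)[OF assms] card \<psi>(1) edge_connected_row_shift_rectangle
    unfolding \<phi> unique_windows_Z_tetromino dom_row_shift_colored by metis
qed (auto simp: Z_tetromino_def)

lemma prismatic_row_shift_colored_iff:
  assumes "n > 0"
  shows "prismatic_polyomino Z_tetromino n (row_shift_colored \<chi>) \<longleftrightarrow>
    prismatic_polyomino square_tetromino n \<chi>"
  unfolding prismatic_square_iff[OF assms] prismatic_Z_iff[OF assms] dom_row_shift_colored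
    n_coloring_row_shift_colored unique_windows_Z_tetromino
  using card_dom_row_shift_colored[of \<chi>] by (simp add: dom_row_shift_colored)

text \<open>For the count up to translation: as \<open>g\<close> preserves and reflects
  \<open>r\<close> and is onto, it carries the class of \<open>x\<close> exactly onto that of
  \<open>g x\<close>.\<close>

lemma bij_betw_image_quotient:
  assumes "bij g" and rel: "\<And>x y. (g x, g y) \<in> r \<longleftrightarrow> (x, y) \<in> r" and "g ` A = B"
  shows "bij_betw (\<lambda>C. g ` C) (A // r) (B // r)"
proof (rule bij_betw_imageI)
  show "inj_on (\<lambda>C. g ` C) (A // r)"
    using inj_image_eq_iff[OF bij_is_inj[OF assms(1)]] by (auto simp: inj_on_def)
  have "g ` (r `` {x}) = r `` {g x}" for x
  proof (intro equalityI subsetI)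
    fix z assume z: "z \<in> r `` {g x}"
    obtain y where "z = g y" using surjD[OF bij_is_surj[OF assms(1)]] by blast
    then show "z \<in> g ` (r `` {x})" using z by (simp add: rel)
  qed (auto simp: rel)
  then show "(\<lambda>C. g ` C) ` (A // r) = B // r"
    using assms(3) by (auto simp: quotient_def)
qed

theorem theorem6p4:
  fixes n :: nat
  assumes "n > 1"
  shows "(\<forall>S \<chi>. n_coloring n S \<chi> \<longrightarrow>
            (prismatic_polyomino square_tetromino n \<chi> \<longleftrightarrow>
             n_coloring n (row_shift ` S) (row_shift_colored \<chi>) \<and>
             prismatic_polyomino Z_tetromino n (row_shift_colored \<chi>)))
       \<and> bij_betw row_shift_colored
           {\<chi>. prismatic_polyomino square_tetromino n \<chi>}
           {\<chi>. prismatic_polyomino Z_tetromino n \<chi>}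
       \<and> bij_betw (\<lambda>C. row_shift_colored ` C)
           ({\<chi>. prismatic_polyomino square_tetromino n \<chi>} // translation_rel)
           ({\<chi>. prismatic_polyomino Z_tetromino n \<chi>} // translation_rel)"
proof -
  have iff: "prismatic_polyomino Z_tetromino n (row_shift_colored \<chi>) \<longleftrightarrow>
      prismatic_polyomino square_tetromino n \<chi>" for \<chi>
    using prismatic_row_shift_colored_iff assms by simp
  have image: "row_shift_colored ` {\<chi>. prismatic_polyomino square_tetromino n \<chi>} =
      {\<chi>. prismatic_polyomino Z_tetromino n \<chi>}"
    using iff bij_is_surj[OF bij_row_shift_colored] by (auto simp: image_iff) (metis surjD)
  show ?thesis
    using iff image n_coloring_row_shift_colored
      bij_betw_image_quotient[OF bij_row_shift_colored translation_rel_row_shift_colored image]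
      bij_betw_imageI[OF inj_on_subset[OF bij_is_inj[OF bij_row_shift_colored]] image]
    by blast
qed

end
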